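(* Let $\mathcal{Q}$ be an optimum achieving (OA) quantization scheme for the quantized primal-dual algorithm. Then $$\liminf_{k\to\infty}\frac1k\log \mathsf{E}\left[\|\boldsymbol{\epsilon}^{\boldsymbol{x}}_k\|_2^2\right]\ \ge\ \frac{2}{M}\left(\sum_{i=1}^M\log\left(1+\mu^\star\frac{d^2U_i}{d(x^i)^2}\left({x^i}^\star\right)\right)-R_{\boldsymbol{\lambda}}\right),$$ where $\boldsymbol{\epsilon}^{\boldsymbol{x}}_k=\boldsymbol{x}_k-\boldsymbol{x}^\star$ and ${x^i}^\star$ is the optimal value of $x^i$.
   Context: **Problem.** Let $N<M$ be positive integers, $A\in\mathbb{R}^{N\times M}$, $\boldsymbol{b}\in\mathbb{R}^N$, $U_i:\mathbb{R}\to\mathbb{R}$ ($1\le i\le M$). Consider: maximize $\sum_{i=1}^M U_i(x^i)$ over $\boldsymbol{x}=[x^1,\dots,x^M]^\top$ subject to $A\boldsymbol{x}=\boldsymbol{b}$. Let $\boldsymbol{x}^\star,\boldsymbol{\lambda}^\star$ be the optimal primal and dual solutions. $A_i$ is the $i$th column of $A$, $\bar A_j$ its $j$th row. **Quantization scheme.** At time $k\ge 0$, agent $i$ encodes $x^i_k$ into a symbol $\hat Q^{\boldsymbol{x}}_{i,k}=E^{\boldsymbol{x}}_{i,k}(\{x^i_n\}_{n=0}^k,\{\hat Q^{\boldsymbol{x}}_{i,n}\}_{n=0}^{k-1})$ in a finite alphabet $\mathcal{A}^{\boldsymbol{x}}_{i,k}$, and the quantized value is reconstructed as $Q^{\boldsymbol{x}}_{i,k}=D^{\boldsymbol{x}}_{i,k}(\{\hat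 Q^{\boldsymbol{x}}_{i,n}\}_{n=0}^k)$. Likewise, network node $j$ ($1\le j\le N$) encodes $\lambda^j_k$ into $\hat Q^{\boldsymbol{\lambda}}_{j,k}=E^{\boldsymbol{\lambda}}_{j,k}(\{\lambda^j_n\}_{n=0}^k,\{\hat Q^{\boldsymbol{\lambda}}_{j,n}\}_{n=0}^{k-1})$ in a finite alphabet $\mathcal{A}^{\boldsymbol{\lambda}}_{j,k}$, with reconstruction $Q^{\boldsymbol{\lambda}}_{j,k}=D^{\boldsymbol{\lambda}}_{j,k}(\{\hat Q^{\boldsymbol{\lambda}}_{j,n}\}_{n=0}^k)$. The collection $\mathcal{Q}$ of all these encoder and decoder maps is a quantization scheme. Write $Q^{\boldsymbol{x}}_k=[Q^{\boldsymbol{x}}_{1,k},\dots,Q^{\boldsymbol{x}}_{M,k}]^\top$, $Q^{\boldsymbol{\lambda}}_k=[Q^{\boldsymbol{\lambda}}_{1,k},\dots,Q^{\boldsymbol{\lambda}}_{N,k}]^\top$. **Quantized primal-dual (PD) algorithm.** For $k\ge1$, $$x^i_k=x^i_{k-1}+\mu_{k-1}\left(U_i'(x^i_{k-1})-A_i^\top Q^{\boldsymbol{\lambda}}_{k-1}\right),\qquad \lambda^j_k=\lambda^j_{k-1}+\mu_{k-1}\left(\bar A_jQ^{\boldsymbol{x}}_{k-1}-b_j\right).$$ The initial vectors $\boldsymbol{x}_0,\boldsymbol{\lambda}_0$ are random with densities $p_{\boldsymbol{x}_0},p_{\boldsymbol{\lambda}_0}$. **Standing assumptions.** (1) Each $U_i$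 is concave and twice continuously differentiable. (2) There are constants with $U_i^{\min}\le U_i''(x)\le U_i^{\max}<0$ for all $x\in\mathbb{R}$ and all $i$. (3) $0<\mu_k<\min_i 1/|U_i^{\min}|$ for all $k$. (4) $\mu_k\to\mu^\star>0$. (5) $\boldsymbol{x}_0$ and $\boldsymbol{\lambda}_0$ are independent and have finite differential entropies ($\mathsf{h}[\boldsymbol{z}]=-\int p_{\boldsymbol{z}}\log p_{\boldsymbol{z}}$). **OA scheme.** $\mathcal{Q}$ is optimum achieving (OA) if under $\mathcal{Q}$, $\lim_k\boldsymbol{x}_k=\boldsymbol{x}^\star$ and $\lim_k\boldsymbol{\lambda}_k=\boldsymbol{\lambda}^\star$, for any initial vectors in the supports of their densities. **Data rate.** $R_{\boldsymbol{\lambda}}=\lim_{k\to\infty}\frac1k\sum_{t=0}^{k-1}\sum_{j=1}^N\log|\mathcal{A}^{\boldsymbol{\lambda}}_{j,t}|$ (limit assumed to exist). Logarithms are natural, with $\log 0=-\infty$. *)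

theory Defs
  imports "HOL-Probability.Probability"
begin

section \<open>The optimization problem and its dual\<close>

definition twice_continuously_differentiable :: "(real \<Rightarrow> real) \<Rightarrow> bool" where
  "twice_continuously_differentiable f \<longleftrightarrow>
     (\<forall>x. f differentiable at x) \<and> (\<forall>x. deriv f differentiable at x) \<and>
     continuous_on UNIV (deriv (deriv f))"

definition objective :: "('m::finite \<Rightarrow> real \<Rightarrow> real) \<Rightarrow> real^'m \<Rightarrow> real" where
  "objective U x = (\<Sum>i\<in>UNIV. U i (x $ i))"

definition primal_optimal ::
    "('m::finite \<Rightarrow> real \<Rightarrow> real) \<Rightarrow> real^'m^'n \<Rightarrow> real^'n \<Rightarrow> real^'m \<Rightarrow> bool" where
  "primal_optimal U A b x \<longleftrightarrow>
     A *v x = b \<and> (\<forall>y. A *v y = b \<longrightarrow> objective U y \<le> objective U x)"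

definition lagrangian ::
    "('m::finite \<Rightarrow> real \<Rightarrow> real) \<Rightarrow> real^'m^'n \<Rightarrow> real^'n \<Rightarrow> real^'m \<Rightarrow> real^'n \<Rightarrow> real" where
  "lagrangian U A b x l = objective U x - l \<bullet> (A *v x - b)"

definition dual_function ::
    "('m::finite \<Rightarrow> real \<Rightarrow> real) \<Rightarrow> real^'m^'n \<Rightarrow> real^'n \<Rightarrow> real^'n \<Rightarrow> ereal" where
  "dual_function U A b l = (SUP x. ereal (lagrangian U A b x l))"

definition dual_optimal ::
    "('m::finite \<Rightarrow> real \<Rightarrow> real) \<Rightarrow> real^'m^'n \<Rightarrow> real^'n \<Rightarrow> real^'n \<Rightarrow> bool" where
  "dual_optimal U A b l \<longleftrightarrow> (\<forall>l'. dual_function U A b l \<le> dual_function U A b l')"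

section \<open>Quantization schemes\<close>

text \<open>
  Agents are indexed by \<open>'m\<close> and network nodes by \<open>'n\<close>. All primal alphabets are subsets of one
  symbol type \<open>'s\<close>, all dual alphabets subsets of \<open>'t\<close>. Histories are lists, oldest entry first:
  at time \<open>k\<close> an encoder receives the \<open>k + 1\<close> values up to time \<open>k\<close> and the \<open>k\<close> symbols before
  time \<open>k\<close>; a decoder receives the \<open>k + 1\<close> symbols up to time \<open>k\<close>.
\<close>

record ('m, 'n, 's, 't) quantization_scheme =
  alphabet_x :: "'m \<Rightarrow> nat \<Rightarrow> 's set"
  encoder_x :: "'m \<Rightarrow> nat \<Rightarrow> real list \<Rightarrow> 's list \<Rightarrow> 's"
  decoder_x :: "'m \<Rightarrow> nat \<Rightarrow> 's list \<Rightarrow> real"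
  alphabet_l :: "'n \<Rightarrow> nat \<Rightarrow> 't set"
  encoder_l :: "'n \<Rightarrow> nat \<Rightarrow> real list \<Rightarrow> 't list \<Rightarrow> 't"
  decoder_l :: "'n \<Rightarrow> nat \<Rightarrow> 't list \<Rightarrow> real"

definition valid_encoder ::
    "(nat \<Rightarrow> 's set) \<Rightarrow> (nat \<Rightarrow> real list \<Rightarrow> 's list \<Rightarrow> 's) \<Rightarrow> bool" where
  "valid_encoder S E \<longleftrightarrow>
     (\<forall>k. finite (S k)) \<and>
     (\<forall>k ys qs. length ys = Suc k \<and> length qs = k \<and> (\<forall>n<k. qs ! n \<in> S n)
        \<longrightarrow> E k ys qs \<in> S k)"

definition valid_scheme :: "('m, 'n, 's, 't) quantization_scheme \<Rightarrow> bool" where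
  "valid_scheme Q \<longleftrightarrow>
     (\<forall>i. valid_encoder (alphabet_x Q i) (encoder_x Q i)) \<and>
     (\<forall>j. valid_encoder (alphabet_l Q j) (encoder_l Q j))"

function qsymbol ::
    "(nat \<Rightarrow> real list \<Rightarrow> 's list \<Rightarrow> 's) \<Rightarrow> (nat \<Rightarrow> real) \<Rightarrow> nat \<Rightarrow> 's" where
  "qsymbol E y k = E k (map y [0..<Suc k]) (map (\<lambda>n. qsymbol E y n) [0..<k])"
  by auto
termination by (relation "Wellfounded.measure (\<lambda>(E, y, k). k)") auto

declare qsymbol.simps [simp del]

definition reconstruction ::
    "(nat \<Rightarrow> real list \<Rightarrow> 's list \<Rightarrow> 's) \<Rightarrow> (nat \<Rightarrow> 's list \<Rightarrow> real) \<Rightarrow> (nat \<Rightarrow> real) \<Rightarrow> nat \<Rightarrow> real"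
  where
  "reconstruction E D y k = D k (map (qsymbol E y) [0..<Suc k])"

definition quantized_x ::
    "('m::finite, 'n, 's, 't) quantization_scheme \<Rightarrow> (nat \<Rightarrow> real^'m) \<Rightarrow> nat \<Rightarrow> real^'m" where
  "quantized_x Q x k = (\<chi> i. reconstruction (encoder_x Q i) (decoder_x Q i) (\<lambda>n. x n $ i) k)"

definition quantized_l ::
    "('m, 'n::finite, 's, 't) quantization_scheme \<Rightarrow> (nat \<Rightarrow> real^'n) \<Rightarrow> nat \<Rightarrow> real^'n" where
  "quantized_l Q l k = (\<chi> j. reconstruction (encoder_l Q j) (decoder_l Q j) (\<lambda>n. l n $ j) k)"

section \<open>The quantized primal-dual algorithm\<close>

text \<open>
  Each pair of initial vectors \<open>x 0\<close>, \<open>l 0\<close> determines exactly one trajectory, since the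
  quantized values at time \<open>k\<close> depend only on \<open>x\<close> and \<open>l\<close> up to time \<open>k\<close>.
\<close>

definition pd_trajectory ::
    "('m::finite \<Rightarrow> real \<Rightarrow> real) \<Rightarrow> real^'m^'n::finite \<Rightarrow> real^'n \<Rightarrow> (nat \<Rightarrow> real) \<Rightarrow>
     ('m, 'n, 's, 't) quantization_scheme \<Rightarrow> (nat \<Rightarrow> real^'m) \<Rightarrow> (nat \<Rightarrow> real^'n) \<Rightarrow> bool" where
  "pd_trajectory U A b \<mu> Q x l \<longleftrightarrow>
     (\<forall>k i. x (Suc k) $ i =
        x k $ i + \<mu> k * (deriv (U i) (x k $ i) - column i A \<bullet> quantized_l Q l k)) \<and>
     (\<forall>k j. l (Suc k) $ j =
        l k $ j + \<mu> k * (row j A \<bullet> quantized_x Q x k - b $ j))"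

text \<open>
  No closure is taken in the support. This makes the property of being optimum achieving weakest,
  so statements that assume it also cover the closed support.
\<close>

definition density_support :: "('v \<Rightarrow> real) \<Rightarrow> 'v set" where
  "density_support p = {z. p z > 0}"

definition optimum_achieving ::
    "('m::finite \<Rightarrow> real \<Rightarrow> real) \<Rightarrow> real^'m^'n::finite \<Rightarrow> real^'n \<Rightarrow> (nat \<Rightarrow> real) \<Rightarrow>
     (real^'m \<Rightarrow> real) \<Rightarrow> (real^'n \<Rightarrow> real) \<Rightarrow> real^'m \<Rightarrow> real^'n \<Rightarrow>
     ('m, 'n, 's, 't) quantization_scheme \<Rightarrow> bool" where
  "optimum_achieving U A b \<mu> px pl xs ls Q \<longleftrightarrow>
     (\<forall>x l. pd_trajectory U A b \<mu> Q x l \<and> x 0 \<in> density_support px \<and> l 0 \<in> density_support pl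
        \<longrightarrow> x \<longlonglongrightarrow> xs \<and> l \<longlonglongrightarrow> ls)"

section \<open>Independence, entropy, data rate, logarithm\<close>

text \<open>
  The library's \<^const>\<open>prob_space.indep_var\<close> needs both random variables to have the same value type.
\<close>

definition independent_vectors ::
    "'w measure \<Rightarrow> ('w \<Rightarrow> 'u::topological_space) \<Rightarrow> ('w \<Rightarrow> 'v::topological_space) \<Rightarrow> bool" where
  "independent_vectors P Y Z \<longleftrightarrow>
     Y \<in> borel_measurable P \<and> Z \<in> borel_measurable P \<and>
     prob_space.indep_set P
       {Y -` B \<inter> space P | B. B \<in> sets borel} {Z -` B \<inter> space P | B. B \<in> sets borel}"

text \<open>
  A Bochner integral that does not exist has value 0, so finiteness of
  \<open>- (\<integral>z. p z * ln (p z) \<partial>lborel)\<close> has to be expressed as integrability.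
\<close>

definition finite_differential_entropy :: "('v::euclidean_space \<Rightarrow> real) \<Rightarrow> bool" where
  "finite_differential_entropy p \<longleftrightarrow> integrable lborel (\<lambda>z. p z * ln (p z))"

definition average_rate_l :: "('m, 'n::finite, 's, 't) quantization_scheme \<Rightarrow> nat \<Rightarrow> ereal" where
  "average_rate_l Q k =
     ereal (1 / real k * (\<Sum>t<k. \<Sum>j\<in>UNIV. ln (real (card (alphabet_l Q j t)))))"

definition data_rate_l :: "('m, 'n::finite, 's, 't) quantization_scheme \<Rightarrow> ereal" where
  "data_rate_l Q = lim (average_rate_l Q)"

text \<open>Unlike \<^const>\<open>ln\<close>, this logarithm is \<open>-\<infinity>\<close> at 0.\<close>

definition elog :: "ennreal \<Rightarrow> ereal" where
  "elog z = (if z = 0 then -\<infinity> else if z = \<top> then \<infinity> else ereal (ln (enn2real z)))"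

end

theory Submission
  imports Defs
begin

text \<open>
  The theorem is a counting statement. The primal iterate \<open>x k\<close> is determined by the initial
  vector \<open>x 0\<close> and the dual symbols sent before time \<open>k\<close>. Once those symbols are fixed,
  \<open>x 0 \<mapsto> x k\<close> acts on every coordinate separately, and at time \<open>t\<close> it
  multiplies distances in coordinate \<open>i\<close> by a slope \<open>1 + \<mu> t * U i''\<close>, taken at an
  intermediate point. The step size condition makes these slopes positive, so distances cannot
  shrink faster than their product. Hence the initial vectors that share a symbol history and end
  within \<open>r\<close> of the optimum fit into a box whose sides are of order \<open>r\<close>
  divided by the product of the slopes; this is \<open>trajectories_expand\<close>.

  The number of symbol histories of length \<open>k\<close> is \<open>exp (k * R)\<close> to first order in the
  exponent. A vector with a density bounded by \<open>C\<close> lies in the union of so many boxes with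
  probability at most \<open>C\<close> times the number of boxes times their volume
  (\<open>prob_le_label_count\<close>). Choosing \<open>r\<close> so small that this bound is 1/4, the
  error exceeds \<open>r\<close> with probability bounded away from 0, so the mean square error is at
  least a constant times \<open>r\<^sup>2\<close>. This gives the estimate \<open>log_mean_square_error_ge\<close>
  at every finite time, and with \<open>M\<close> coordinates the factor
  \<open>2 / M\<close> comes from solving \<open>r ^ M = slopes / histories\<close> for \<open>r\<^sup>2\<close>.

  It remains to control the density and the slopes. Optimum achievement makes the iterates converge
  almost surely. So there is an event of probability at least 1/2 on which the density at
  \<open>x 0\<close> is bounded by a constant and the iterates are, from a fixed time on, uniformly
  close to the optimum (\<open>prob_bounded_density_near_limit_tendsto_1\<close>, an argument in the
  style of Egorov). There, by continuity of \<open>U i''\<close>, the slopes exceed any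
  \<open>a i < 1 + \<mu>\<^sup>* * U i'' (x\<^sup>* i)\<close>. The finitely many earlier slopes only contribute a
  constant, which disappears in the exponential rate. Finally \<open>a i\<close> tends to its upper
  bound; if that bound is 0 for some \<open>i\<close>, or if the rate is infinite, then the right-hand
  side of the theorem is \<open>-\<infinity>\<close>. Counting boxes is the volume counterpart of the
  entropy estimate \<open>h (x k) \<ge> h (x 0) + E log (slopes) - log (histories)\<close>.
\<close>

section \<open>Dual symbol histories\<close>

lemma qsymbol_in_alphabet:
  assumes "valid_encoder S E"
  shows "qsymbol E y k \<in> S k"
proof (induction k rule: less_induct)
  case (less k)
  show ?case
  proof -
    have "length (map y [0..<Suc k]) = Suc k \<and> length (map (qsymbol E y) [0..<k]) = k \<and>
        (\<forall>n<k. map (qsymbol E y) [0..<k] ! n \<in> S n)"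
      using less by simp
    then show ?thesis
      using assms unfolding valid_encoder_def by (subst qsymbol.simps) blast
  qed
qed

text \<open>
  Nonemptiness is forced because an encoder has to answer whatever it is fed; in particular no
  term of the data rate is the logarithm of 0.
\<close>

lemma card_alphabet_pos:
  assumes "valid_encoder S E"
  shows "0 < card (S k)"
  using qsymbol_in_alphabet[OF assms, of undefined k] assms
  by (auto simp: valid_encoder_def card_gt_0_iff)

definition dual_symbols ::
    "('m, 'n, 's, 't) quantization_scheme \<Rightarrow> (nat \<Rightarrow> real^'n::finite) \<Rightarrow> nat \<Rightarrow> nat \<times> 'n \<Rightarrow> 't" where
  "dual_symbols Q l k =
     (\<lambda>(t, j)\<in>{..<k} \<times> UNIV. qsymbol (encoder_l Q j) (\<lambda>n. l n $ j) t)"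

definition dual_histories ::
    "('m, 'n::finite, 's, 't) quantization_scheme \<Rightarrow> nat \<Rightarrow> (nat \<times> 'n \<Rightarrow> 't) set" where
  "dual_histories Q k = Pi\<^sub>E ({..<k} \<times> UNIV) (\<lambda>(t, j). alphabet_l Q j t)"

lemma dual_symbols_in_histories:
  assumes "valid_scheme Q"
  shows "dual_symbols Q l k \<in> dual_histories Q k"
  using assms by (auto simp: dual_symbols_def dual_histories_def valid_scheme_def intro: qsymbol_in_alphabet)

lemma finite_dual_histories:
  assumes "valid_scheme Q"
  shows "finite (dual_histories Q k)"
  unfolding dual_histories_def using assms
  by (intro finite_PiE) (auto simp: valid_scheme_def valid_encoder_def)

lemma card_dual_histories:
  "card (dual_histories Q k) = (\<Prod>t<k. \<Prod>j\<in>UNIV. card (alphabet_l Q j t))"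
  unfolding dual_histories_def
  by (subst card_PiE) (auto simp: prod.cartesian_product intro!: prod.cong)

lemma card_dual_histories_pos:
  assumes "valid_scheme Q"
  shows "0 < card (dual_histories Q k)"
  using assms unfolding card_dual_histories
  by (auto simp: valid_scheme_def intro!: prod_pos card_alphabet_pos)

lemma ln_card_dual_histories:
  assumes "valid_scheme Q"
  shows "ln (real (card (dual_histories Q k))) =
    (\<Sum>t<k. \<Sum>j\<in>UNIV. ln (real (card (alphabet_l Q j t))))"
proof -
  have pos: "real (card (alphabet_l Q j t)) \<noteq> 0" for j t
    using assms card_alphabet_pos[of "alphabet_l Q j" "encoder_l Q j" t]
    by (auto simp: valid_scheme_def)
  show ?thesis
    unfolding card_dual_histories of_nat_prod
    by (subst ln_prod) (use pos in \<open>auto simp: ln_prod\<close>)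
qed

text \<open>
  The primal update sees the dual iterates through the transmitted symbols only. This causality is
  what lets the symbol history stand in for the whole dual trajectory.
\<close>

lemma quantized_l_cong_dual_symbols:
  assumes "dual_symbols Q l k = dual_symbols Q l' k" and "t < k"
  shows "quantized_l Q l t = quantized_l Q l' t"
proof -
  have "qsymbol (encoder_l Q j) (\<lambda>n. l n $ j) n = qsymbol (encoder_l Q j) (\<lambda>n. l' n $ j) n"
    if "n < k" for n j
    using fun_cong[OF assms(1), of "(n, j)"] that by (simp add: dual_symbols_def)
  then show ?thesis
    using assms(2) unfolding quantized_l_def reconstruction_def
    by (auto simp: vec_eq_iff simp del: upt_Suc intro!: arg_cong2[where f = "decoder_l Q _"] arg_cong[where f = "decoder_l Q _ t"])
qed

section \<open>Separation of primal trajectories\<close>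

text \<open>
  The mean value theorem, in the form that \<open>w + m * f' w - s * w\<close> is nondecreasing between
  \<open>y\<close> and \<open>z\<close>. The slope is only needed on the segment between the two points,
  which later allows a local bound near the optimum.
\<close>

lemma gradient_step_expands:
  fixes f :: "real \<Rightarrow> real"
  assumes "twice_continuously_differentiable f"
    and slope: "\<And>w. w \<in> closed_segment y z \<Longrightarrow> s \<le> 1 + m * deriv (deriv f) w"
  shows "s * \<bar>y - z\<bar> \<le> \<bar>(y + m * deriv f y) - (z + m * deriv f z)\<bar>"
  using slope
proof (induction y z rule: linorder_wlog)
  case (le y z)
  have "(deriv f has_real_derivative deriv (deriv f) w) (at w)" for w
    using assms(1) by (simp add: twice_continuously_differentiable_def DERIV_deriv_iff_real_differentiable)
  then have der: "((\<lambda>w. w + m * deriv f w - s * w) has_real_derivative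
      1 + m * deriv (deriv f) w - s) (at w)" for w
    by (auto intro!: derivative_eq_intros)
  have "(y + m * deriv f y - s * y) \<le> (z + m * deriv f z - s * z)"
    using le by (intro DERIV_nonneg_imp_nondecreasing[OF le(1)] exI[of _ "1 + m * deriv (deriv f) _ - s"])
      (auto intro!: der simp: closed_segment_eq_real_ivl)
  then show ?case using le(1) by (simp add: algebra_simps abs_real_def)
next
  case (sym y z)
  then show ?case by (simp add: closed_segment_commute abs_minus_commute)
qed

text \<open>
  With equal symbol histories the two trajectories receive the same dual feedback, which cancels in
  their difference. What remains in coordinate \<open>i\<close> is a composition of scalar gradient steps.
\<close>

lemma trajectories_expand:
  assumes traj: "pd_trajectory U A b \<mu> Q x l" "pd_trajectory U A b \<mu> Q x' l'"
    and symbols: "dual_symbols Q l k = dual_symbols Q l' k"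
    and C2: "twice_continuously_differentiable (U i)"
    and s_nonneg: "\<And>t. t < k \<Longrightarrow> 0 \<le> s t"
    and slope: "\<And>t w. t < k \<Longrightarrow> w \<in> closed_segment (x t $ i) (x' t $ i) \<Longrightarrow>
      s t \<le> 1 + \<mu> t * deriv (deriv (U i)) w"
  shows "(\<Prod>t<k. s t) * \<bar>x 0 $ i - x' 0 $ i\<bar> \<le> \<bar>x k $ i - x' k $ i\<bar>"
proof -
  have "n \<le> k \<Longrightarrow> (\<Prod>t<n. s t) * \<bar>x 0 $ i - x' 0 $ i\<bar> \<le> \<bar>x n $ i - x' n $ i\<bar>" for n
  proof (induction n)
    case (Suc n)
    have step: "x (Suc n) $ i - x' (Suc n) $ i =
        (x n $ i + \<mu> n * deriv (U i) (x n $ i)) - (x' n $ i + \<mu> n * deriv (U i) (x' n $ i))"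
    proof -
      have "x (Suc n) $ i = x n $ i + \<mu> n * (deriv (U i) (x n $ i) - column i A \<bullet> quantized_l Q l n)"
        and "x' (Suc n) $ i = x' n $ i + \<mu> n * (deriv (U i) (x' n $ i) - column i A \<bullet> quantized_l Q l' n)"
        using traj by (auto simp: pd_trajectory_def)
      then show ?thesis
        using quantized_l_cong_dual_symbols[OF symbols, of n] Suc.prems by (simp add: algebra_simps)
    qed
    have "(\<Prod>t<Suc n. s t) * \<bar>x 0 $ i - x' 0 $ i\<bar> = s n * ((\<Prod>t<n. s t) * \<bar>x 0 $ i - x' 0 $ i\<bar>)"
      by simp
    also have "\<dots> \<le> s n * \<bar>x n $ i - x' n $ i\<bar>"
      using Suc s_nonneg[of n] by (intro mult_left_mono) auto
    also have "\<dots> \<le> \<bar>x (Suc n) $ i - x' (Suc n) $ i\<bar>"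
      unfolding step using Suc.prems by (intro gradient_step_expands[OF C2] slope) auto
    finally show ?case .
  qed simp
  then show ?thesis by simp
qed

text \<open>
  The same \<open>n\<close> serves as a starting time and as the inverse radius of the neighbourhood, so
  that bounds for finitely many coordinates can be combined by taking \<open>n\<close> large.
\<close>

lemma eventually_slope_near:
  fixes f :: "real \<Rightarrow> real"
  assumes cont: "isCont f c" and lim: "\<mu> \<longlonglongrightarrow> \<mu>s" and less: "a < 1 + \<mu>s * f c"
  shows "\<forall>\<^sub>F n in sequentially. \<forall>t\<ge>n. \<forall>w. \<bar>w - c\<bar> \<le> 1 / real (Suc n) \<longrightarrow> a \<le> 1 + \<mu> t * f w"
proof -
  have "((\<lambda>(t, w). 1 + \<mu> t * f w) \<longlongrightarrow> 1 + \<mu>s * f c) (sequentially \<times>\<^sub>F nhds c)"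
    unfolding case_prod_unfold
    by (intro tendsto_intros filterlim_compose[OF lim] filterlim_fst
        filterlim_compose[OF cont[unfolded isCont_def tendsto_at_iff_tendsto_nhds]] filterlim_snd)
  from order_tendstoD(1)[OF this less]
  obtain Pt Pw where Pt: "eventually Pt sequentially" and Pw: "eventually Pw (nhds c)"
    and imp: "\<And>t w. Pt t \<Longrightarrow> Pw w \<Longrightarrow> a < 1 + \<mu> t * f w"
    unfolding eventually_prod_filter by auto
  from Pt obtain N where N: "\<And>t. t \<ge> N \<Longrightarrow> Pt t"
    unfolding eventually_sequentially by auto
  from Pw obtain d where d: "d > 0" "\<And>w. dist w c < d \<Longrightarrow> Pw w"
    unfolding eventually_nhds_metric by auto
  from reals_Archimedean[OF d(1)] obtain K where K: "inverse (real (Suc K)) < d" by auto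
  have "a \<le> 1 + \<mu> t * f w" if "n \<ge> max N K" "t \<ge> n" "\<bar>w - c\<bar> \<le> 1 / real (Suc n)" for n t w
  proof -
    have "1 / real (Suc n) \<le> inverse (real (Suc K))"
      using that by (simp add: field_simps)
    with that K have "dist w c < d" by (simp add: dist_real_def)
    with imp[of t w] N[of t] d(2) that show ?thesis by fastforce
  qed
  then show ?thesis unfolding eventually_sequentially by blast
qed

section \<open>Covering by boxes, one for each label\<close>

text \<open>
  All values of \<open>Y\<close> that carry one label lie in the box with half side lengths
  \<open>D i\<close> around any one of them. Replacing each label class by its box avoids any question
  whether \<open>\<sigma>\<close> is measurable, which matters because encoders are arbitrary functions.
\<close>

lemma prob_le_label_count:
  fixes Y :: "'w \<Rightarrow> real^'m" and D :: "'m::finite \<Rightarrow> real" and C :: real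
  assumes "prob_space P"
    and dens: "distributed P lborel Y (\<lambda>z. ennreal (p z))"
    and S: "S \<in> sets P" and C: "0 \<le> C" "\<And>\<omega>. \<omega> \<in> S \<Longrightarrow> p (Y \<omega>) \<le> C"
    and label: "finite H" "\<sigma> ` S \<subseteq> H" and D: "\<And>i. 0 \<le> D i"
    and close: "\<And>\<omega> \<omega>' i. \<omega> \<in> S \<Longrightarrow> \<omega>' \<in> S \<Longrightarrow> \<sigma> \<omega> = \<sigma> \<omega>' \<Longrightarrow> \<bar>Y \<omega> $ i - Y \<omega>' $ i\<bar> \<le> D i"
  shows "measure P S \<le> real (card H) * (C * (\<Prod>i\<in>UNIV. 2 * D i))"
proof -
  interpret prob_space P by fact
  define V where "V = (\<Prod>i\<in>UNIV. 2 * D i)"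
  have V: "0 \<le> V" using D by (auto simp: V_def intro!: prod_nonneg)
  \<comment> \<open>an arbitrary centre when no point of \<open>S\<close> has label \<open>h\<close>; such boxes are harmless\<close>
  define c where "c h = Y (SOME \<omega>. \<omega> \<in> S \<and> \<sigma> \<omega> = h)" for h
  define B where "B h = cbox (c h - (\<chi> i. D i)) (c h + (\<chi> i. D i)) \<inter> {z. p z \<le> C}" for h
  have Ym: "Y \<in> measurable P lborel" and pm: "(\<lambda>z. ennreal (p z)) \<in> borel_measurable lborel"
    using dens by (auto simp: distributed_def)
  have "{z. p z \<le> C} = {z \<in> space lborel. ennreal (p z) \<le> ennreal C}"
    using C(1) by (auto simp: ennreal_le_iff)
  also have "\<dots> \<in> sets lborel" using pm by measurable
  finally have Bm: "B h \<in> sets lborel" for h unfolding B_def by auto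
  have vol: "emeasure lborel (cbox (c h - (\<chi> i. D i)) (c h + (\<chi> i. D i))) = ennreal V" for h
  proof -
    have ne: "cbox (c h - (\<chi> i. D i)) (c h + (\<chi> i. D i)) \<noteq> {}"
      using D by (auto simp: interval_ne_empty_cart)
    show ?thesis
      unfolding V_def using content_cbox_cart[OF ne]
      by (subst emeasure_eq_ennreal_measure) (auto simp: emeasure_lborel_cbox_eq)
  qed
  have box_prob: "measure P (Y -` B h \<inter> space P) \<le> C * V" for h
  proof -
    have "emeasure P (Y -` B h \<inter> space P) = (\<integral>\<^sup>+z. ennreal (p z) * indicator (B h) z \<partial>lborel)"
      using dens Bm by (rule distributed_emeasure)
    also have "\<dots> \<le> (\<integral>\<^sup>+z. ennreal C *
        indicator (cbox (c h - (\<chi> i. D i)) (c h + (\<chi> i. D i))) z \<partial>lborel)"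
      by (intro nn_integral_mono) (auto simp: B_def indicator_def intro!: ennreal_leI)
    also have "\<dots> = ennreal (C * V)"
      using C V by (simp add: nn_integral_cmult_indicator vol ennreal_mult)
    finally show ?thesis
      using C V by (simp add: emeasure_eq_measure)
  qed
  have cover: "S \<subseteq> (\<Union>h\<in>H. Y -` B h \<inter> space P)"
  proof
    fix \<omega> assume \<omega>: "\<omega> \<in> S"
    define \<omega>' where "\<omega>' = (SOME v. v \<in> S \<and> \<sigma> v = \<sigma> \<omega>)"
    have \<omega>': "\<omega>' \<in> S \<and> \<sigma> \<omega>' = \<sigma> \<omega>"
      unfolding \<omega>'_def by (rule someI[of _ \<omega>]) (simp add: \<omega>)
    have "c (\<sigma> \<omega>) = Y \<omega>'"
      unfolding c_def \<omega>'_def ..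
    with close[OF \<omega>, of \<omega>'] \<omega>' have "\<bar>Y \<omega> $ i - c (\<sigma> \<omega>) $ i\<bar> \<le> D i" for i
      by metis
    then have "Y \<omega> \<in> B (\<sigma> \<omega>)"
      using C(2)[OF \<omega>] by (auto simp: B_def mem_box_cart abs_le_iff algebra_simps)
    then show "\<omega> \<in> (\<Union>h\<in>H. Y -` B h \<inter> space P)"
      using \<omega> label sets.sets_into_space[OF S] by auto
  qed
  have meas: "Y -` B h \<inter> space P \<in> sets P" for h
    using Ym Bm by (rule measurable_sets)
  have "measure P S \<le> measure P (\<Union>h\<in>H. Y -` B h \<inter> space P)"
    using meas label by (intro finite_measure_mono cover sets.finite_UN) auto
  also have "\<dots> \<le> (\<Sum>h\<in>H. measure P (Y -` B h \<inter> space P))"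
    using meas label by (intro finite_measure_subadditive_finite) auto
  also have "\<dots> \<le> (\<Sum>h\<in>H. C * V)"
    by (intro sum_mono box_prob)
  finally show ?thesis by (simp add: V_def)
qed

section \<open>The mean square error at a finite time\<close>

lemma elog_mono:
  assumes "y \<le> z"
  shows "elog y \<le> elog z"
proof (cases "y = 0 \<or> z = \<top>")
  case True
  then show ?thesis using assms by (auto simp: elog_def)
next
  case False
  with assms have "y < \<top>" "0 < y" "z < \<top>" "0 < z"
    by (auto simp: less_top[symmetric] top_unique zero_less_iff_neq_zero)
  moreover have "0 < enn2real y" "enn2real y \<le> enn2real z"
    using calculation assms by (auto simp: enn2real_positive_iff intro: enn2real_mono)
  ultimately show ?thesis by (auto simp: elog_def)
qed

lemma elog_ennreal: "elog (ennreal x) = (if 0 < x then ereal (ln x) else -\<infinity>)"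
  by (auto simp: elog_def ennreal_eq_0_iff)

lemma mean_square_ge_of_escape:
  fixes Z :: "'w \<Rightarrow> 'v::euclidean_space"
  assumes "prob_space P" and Z: "Z \<in> borel_measurable P" and G: "G \<in> sets P" "1 / 2 \<le> measure P G"
    and near: "measure P {\<omega> \<in> G. norm (Z \<omega> - c) \<le> r} \<le> 1 / 4" and r: "0 \<le> r"
  shows "ennreal (r\<^sup>2 / 4) \<le> (\<integral>\<^sup>+\<omega>. ennreal ((norm (Z \<omega> - c))\<^sup>2) \<partial>P)"
proof -
  interpret prob_space P by fact
  define B where "B = {\<omega> \<in> G. norm (Z \<omega> - c) \<le> r}"
  have "{\<omega> \<in> space P. norm (Z \<omega> - c) \<le> r} \<in> sets P"
    using Z by measurable
  then have "G \<inter> {\<omega> \<in> space P. norm (Z \<omega> - c) \<le> r} \<in> sets P"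
    using G by blast
  also have "G \<inter> {\<omega> \<in> space P. norm (Z \<omega> - c) \<le> r} = B"
    using sets.sets_into_space[OF G(1)] by (auto simp: B_def)
  finally have B: "B \<in> sets P" .
  have "measure P (G - B) = measure P G - measure P B"
    using G B by (intro finite_measure_Diff) (auto simp: B_def)
  then have "1 / 4 \<le> measure P (G - B)"
    using G(2) near by (simp add: B_def)
  then have "r\<^sup>2 * (1 / 4) \<le> r\<^sup>2 * measure P (G - B)"
    by (intro mult_left_mono) auto
  then have "ennreal (r\<^sup>2 / 4) \<le> ennreal (r\<^sup>2) * emeasure P (G - B)"
    by (simp add: emeasure_eq_measure ennreal_mult[symmetric] ennreal_leI)
  also have "\<dots> = (\<integral>\<^sup>+\<omega>. ennreal (r\<^sup>2) * indicator (G - B) \<omega> \<partial>P)"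
    using G B by (simp add: nn_integral_cmult_indicator)
  also have "\<dots> \<le> (\<integral>\<^sup>+\<omega>. ennreal ((norm (Z \<omega> - c))\<^sup>2) \<partial>P)"
    using r by (intro nn_integral_mono)
      (auto simp: B_def indicator_def not_le intro!: ennreal_leI power_mono)
  finally show ?thesis .
qed

text \<open>
  The bound at time \<open>k\<close>, with all constants explicit. The covering argument is applied to
  the outcomes of \<open>G\<close> that end within \<open>r\<close> of \<open>xs\<close>, labelled by their
  dual symbol histories: two of them with the same label are at most \<open>2 * r\<close> apart at time
  \<open>k\<close>, hence at most \<open>2 * r\<close> divided by the product of the slopes apart at
  time 0.
\<close>

lemma log_mean_square_error_ge:
  fixes X :: "nat \<Rightarrow> 'w \<Rightarrow> real^'m::finite" and L :: "nat \<Rightarrow> 'w \<Rightarrow> real^'n::finite"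
    and s :: "'m \<Rightarrow> nat \<Rightarrow> real" and C :: real
  assumes prob: "prob_space P"
    and dens: "distributed P lborel (X 0) (\<lambda>z. ennreal (px z))"
    and X: "X k \<in> borel_measurable P"
    and algorithm: "\<And>\<omega>. \<omega> \<in> space P \<Longrightarrow> pd_trajectory U A b \<mu> Q (\<lambda>k. X k \<omega>) (\<lambda>k. L k \<omega>)"
    and scheme: "valid_scheme Q"
    and C2: "\<And>i. twice_continuously_differentiable (U i)"
    and G: "G \<in> sets P" "1 / 2 \<le> measure P G"
    and C: "0 < C" "\<And>\<omega>. \<omega> \<in> G \<Longrightarrow> px (X 0 \<omega>) \<le> C"
    and s_pos: "\<And>i t. 0 < s i t"
    and slope: "\<And>\<omega> \<omega>' i t w. \<lbrakk>\<omega> \<in> G; \<omega>' \<in> G; t < k;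
      w \<in> closed_segment (X t \<omega> $ i) (X t \<omega>' $ i)\<rbrakk> \<Longrightarrow> s i t \<le> 1 + \<mu> t * deriv (deriv (U i)) w"
  shows "ereal (2 / real CARD('m) * ((\<Sum>i\<in>UNIV. \<Sum>t<k. ln (s i t)) - ln (4 * C)
      - (\<Sum>t<k. \<Sum>j\<in>UNIV. ln (real (card (alphabet_l Q j t))))) - ln 64)
    \<le> elog (\<integral>\<^sup>+\<omega>. ennreal ((norm (X k \<omega> - xs))\<^sup>2) \<partial>P)"
proof -
  interpret prob_space P by fact
  define M where "M = real CARD('m)"
  define p where "p i = (\<Prod>t<k. s i t)" for i
  define N where "N = real (card (dual_histories Q k))"
  have M: "0 < M" by (simp add: M_def)
  have p: "0 < p i" for i using s_pos by (auto simp: p_def intro!: prod_pos)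
  have N: "0 < N" using card_dual_histories_pos[OF scheme] by (simp add: N_def)
  have ln_p: "(\<Sum>t<k. ln (s i t)) = ln (p i)" for i
    unfolding p_def using s_pos by (subst ln_prod) (auto simp: less_imp_neq[symmetric])
  \<comment> \<open>the radius for which the covering bound for the near event is exactly 1/4\<close>
  define r where "r = exp (((\<Sum>i\<in>UNIV. ln (p i)) - ln (4 * C) - ln N) / M) / 4"
  have r: "0 < r" by (simp add: r_def)
  have ln_r: "ln (4 * r) * M = (\<Sum>i\<in>UNIV. ln (p i)) - ln (4 * C) - ln N"
    using M by (simp add: r_def)
  define B where "B = {\<omega> \<in> G. norm (X k \<omega> - xs) \<le> r}"
  have "{\<omega> \<in> space P. norm (X k \<omega> - xs) \<le> r} \<in> sets P"
    using X by measurable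
  then have "G \<inter> {\<omega> \<in> space P. norm (X k \<omega> - xs) \<le> r} \<in> sets P"
    using G by blast
  also have "G \<inter> {\<omega> \<in> space P. norm (X k \<omega> - xs) \<le> r} = B"
    using sets.sets_into_space[OF G(1)] by (auto simp: B_def)
  finally have B: "B \<in> sets P" .
  have "measure P B \<le> N * (C * (\<Prod>i\<in>UNIV. 2 * (2 * r / p i)))"
    unfolding N_def
  proof (rule prob_le_label_count[OF prob dens B])
    show "finite (dual_histories Q k)" by (rule finite_dual_histories[OF scheme])
    show "(\<lambda>\<omega>. dual_symbols Q (\<lambda>t. L t \<omega>) k) ` B \<subseteq> dual_histories Q k"
      using dual_symbols_in_histories[OF scheme] by blast
    fix \<omega> \<omega>' i
    assume \<omega>: "\<omega> \<in> B" "\<omega>' \<in> B"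
      and same: "dual_symbols Q (\<lambda>t. L t \<omega>) k = dual_symbols Q (\<lambda>t. L t \<omega>') k"
    from \<omega> have \<omega>G: "\<omega> \<in> G" "\<omega>' \<in> G" by (auto simp: B_def)
    then have sp: "\<omega> \<in> space P" "\<omega>' \<in> space P"
      using sets.sets_into_space[OF G(1)] by auto
    have "p i * \<bar>X 0 \<omega> $ i - X 0 \<omega>' $ i\<bar> \<le> \<bar>X k \<omega> $ i - X k \<omega>' $ i\<bar>"
      unfolding p_def using s_pos[of i]
      by (intro trajectories_expand[OF algorithm[OF sp(1)] algorithm[OF sp(2)] same C2]
          slope[OF \<omega>G]) (auto intro: less_imp_le)
    also have "\<dots> = \<bar>(X k \<omega> - xs) $ i - (X k \<omega>' - xs) $ i\<bar>" by simp
    also have "\<dots> \<le> norm (X k \<omega> - xs) + norm (X k \<omega>' - xs)"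
      using component_le_norm_cart[of "X k \<omega> - xs" i] component_le_norm_cart[of "X k \<omega>' - xs" i]
      by linarith
    also have "\<dots> \<le> 2 * r" using \<omega> by (simp add: B_def)
    finally show "\<bar>X 0 \<omega> $ i - X 0 \<omega>' $ i\<bar> \<le> 2 * r / p i"
      using p[of i] by (simp add: field_simps)
  qed (use C r p in \<open>auto simp: B_def less_imp_le\<close>)
  also have "(\<Prod>i\<in>UNIV. 2 * (2 * r / p i)) = exp (\<Sum>i\<in>(UNIV::'m set). ln (4 * r) - ln (p i))"
    unfolding exp_sum[OF finite]
    using r p by (intro prod.cong) (auto simp: exp_diff)
  also have "(\<Sum>i\<in>(UNIV::'m set). ln (4 * r) - ln (p i)) = ln (1 / (4 * C * N))"
    using ln_r C N by (simp add: sum_subtractf M_def ln_div ln_mult mult.commute)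
  also have "N * (C * exp (ln (1 / (4 * C * N)))) = 1 / 4"
    using C N by simp
  finally have "measure P B \<le> 1 / 4" .
  then have "ennreal (r\<^sup>2 / 4) \<le> (\<integral>\<^sup>+\<omega>. ennreal ((norm (X k \<omega> - xs))\<^sup>2) \<partial>P)"
    unfolding B_def using r G by (intro mean_square_ge_of_escape[OF prob X]) auto
  then have "elog (ennreal (r\<^sup>2 / 4)) \<le> elog (\<integral>\<^sup>+\<omega>. ennreal ((norm (X k \<omega> - xs))\<^sup>2) \<partial>P)"
    by (rule elog_mono)
  moreover have "ln (r\<^sup>2 / 4) = 2 * ln (4 * r) - ln 64"
  proof -
    have "ln (4 ^ 3 :: real) = 3 * ln 4" by (subst ln_realpow) auto
    then show ?thesis
      using r by (simp add: ln_div ln_mult ln_realpow)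
  qed
  moreover have "ln (4 * r) = ((\<Sum>i\<in>UNIV. ln (p i)) - ln (4 * C) - ln N) / M"
    using ln_r M by (simp add: field_simps)
  ultimately show ?thesis
    using r ln_card_dual_histories[OF scheme, of k]
    by (simp add: elog_ennreal ln_p M_def N_def)
qed

section \<open>Passage to the limit\<close>

lemma sum_ereal_eq_MInfty:
  fixes f :: "'a \<Rightarrow> ereal"
  assumes "finite I" and "\<And>i. i \<in> I \<Longrightarrow> f i \<noteq> \<infinity>" and "j \<in> I" and "f j = -\<infinity>"
  shows "sum f I = -\<infinity>"
proof -
  have "sum f I = f j + sum f (I - {j})"
    using assms by (simp add: sum.remove)
  moreover have "sum f (I - {j}) \<noteq> \<infinity>"
    using assms by (auto simp: sum_Pinfty)
  ultimately show ?thesis using assms by (cases "sum f (I - {j})") auto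
qed

lemma data_rate_l_nonneg:
  assumes "valid_scheme Q" and "convergent (average_rate_l Q)"
  shows "0 \<le> data_rate_l Q"
proof -
  have "0 \<le> average_rate_l Q k" for k
    using card_dual_histories_pos[OF assms(1), of k]
    by (simp add: average_rate_l_def flip: ln_card_dual_histories[OF assms(1)])
  then show ?thesis
    using assms(2) unfolding convergent_LIMSEQ_iff data_rate_l_def
    by (intro LIMSEQ_le_const) auto
qed

text \<open>
  The events increase with \<open>n\<close>, and almost every outcome belongs to one of them: any
  value of the density is finite, and a convergent sequence is eventually close to its limit.
  Continuity of the measure from below gives the uniformity that almost sure convergence lacks.
\<close>

lemma prob_bounded_density_near_limit_tendsto_1:
  fixes X :: "nat \<Rightarrow> 'w \<Rightarrow> 'v::euclidean_space"
  assumes "prob_space P" and dens: "distributed P lborel Y (\<lambda>z. ennreal (p z))"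
    and X: "\<And>t. X t \<in> borel_measurable P" and lim: "AE \<omega> in P. (\<lambda>t. X t \<omega>) \<longlonglongrightarrow> c"
    and \<rho>: "0 < \<rho>"
  defines "G \<equiv> \<lambda>n. {\<omega> \<in> space P. p (Y \<omega>) \<le> real n \<and> (\<forall>t\<ge>n. norm (X t \<omega> - c) \<le> \<rho>)}"
  shows "G n \<in> sets P" and "(\<lambda>n. measure P (G n)) \<longlonglongrightarrow> 1"
proof -
  interpret prob_space P by fact
  have Y: "Y \<in> measurable P lborel" and p: "(\<lambda>z. ennreal (p z)) \<in> borel_measurable lborel"
    using dens by (auto simp: distributed_def)
  have "(\<lambda>\<omega>. ennreal (p (Y \<omega>))) \<in> borel_measurable P"
    using measurable_compose[OF Y p] .
  then have "{\<omega> \<in> space P. ennreal (p (Y \<omega>)) \<le> ennreal (real n)} \<in> sets P" for n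
    by measurable
  then have pG: "{\<omega> \<in> space P. p (Y \<omega>) \<le> real n} \<in> sets P" for n
    by (simp add: ennreal_le_iff)
  have "{\<omega> \<in> space P. \<forall>t\<ge>n. norm (X t \<omega> - c) \<le> \<rho>} \<in> sets P" for n
    using X by measurable
  from sets.Int[OF pG this] show G: "G n \<in> sets P" for n
    unfolding G_def by (rule back_subst[of "\<lambda>S. S \<in> sets P"]) auto
  have "incseq G"
    by (rule incseq_SucI) (auto simp: G_def)
  then have "(\<lambda>n. measure P (G n)) \<longlonglongrightarrow> measure P (\<Union>n. G n)"
    using G by (intro finite_Lim_measure_incseq) auto
  also have "measure P (\<Union>n. G n) = 1"
  proof (rule prob_eq_1[THEN iffD2])
    show "(\<Union>n. G n) \<in> sets P" using G by auto
    show "AE \<omega> in P. \<omega> \<in> (\<Union>n. G n)"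
      using lim AE_space
    proof eventually_elim
      case (elim \<omega>)
      from tendstoD[OF elim(1) \<rho>] obtain n0 where n0: "\<And>t. t \<ge> n0 \<Longrightarrow> norm (X t \<omega> - c) \<le> \<rho>"
        unfolding eventually_sequentially dist_norm by (meson less_imp_le)
      obtain n1 where n1: "p (Y \<omega>) \<le> real n1" using real_arch_simple by blast
      have "\<omega> \<in> G (max n0 n1)"
        using n0 n1 elim(2) by (auto simp: G_def)
      then show ?case by blast
    qed
  qed
  finally show "(\<lambda>n. measure P (G n)) \<longlonglongrightarrow> 1" .
qed

lemma AE_density_pos:
  assumes "prob_space P" and dens: "distributed P lborel Y (\<lambda>z. ennreal (p z))"
  shows "AE \<omega> in P. 0 < p (Y \<omega>)"
proof -
  interpret prob_space P by fact
  have "(\<lambda>z. ennreal (p z)) \<in> borel_measurable lborel"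
    using dens by (auto simp: distributed_def)
  then have "Measurable.pred lborel (\<lambda>z. 0 < ennreal (p z))" by measurable
  then show ?thesis
    by (subst distributed_AE2[OF dens]) (auto simp: ennreal_less_zero_iff)
qed

text \<open>
  The numbers \<open>a i\<close> stay strictly below the limiting slopes so that they bound the actual
  slopes at all sufficiently late times, on a whole neighbourhood of the optimum.
\<close>

lemma liminf_log_mean_square_error_ge:
  fixes U :: "'m::finite \<Rightarrow> real \<Rightarrow> real" and A :: "real^'m^'n::finite"
    and X :: "nat \<Rightarrow> 'w \<Rightarrow> real^'m" and a :: "'m \<Rightarrow> real"
  assumes prob: "prob_space P"
    and dens: "distributed P lborel (X 0) (\<lambda>z. ennreal (px z))"
    and X: "\<And>k. X k \<in> borel_measurable P"
    and lim: "AE \<omega> in P. (\<lambda>k. X k \<omega>) \<longlonglongrightarrow> xs"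
    and algorithm: "\<And>\<omega>. \<omega> \<in> space P \<Longrightarrow> pd_trajectory U A b \<mu> Q (\<lambda>k. X k \<omega>) (\<lambda>k. L k \<omega>)"
    and scheme: "valid_scheme Q"
    and C2: "\<And>i. twice_continuously_differentiable (U i)"
    and Umin: "\<And>i x. Umin i \<le> deriv (deriv (U i)) x"
    and \<mu>: "\<And>k. 0 \<le> \<mu> k" "\<And>k i. 0 < 1 + \<mu> k * Umin i" "\<mu> \<longlonglongrightarrow> \<mu>s"
    and a: "\<And>i. 0 < a i" "\<And>i. a i < 1 + \<mu>s * deriv (deriv (U i)) (xs $ i)"
    and rate: "average_rate_l Q \<longlonglongrightarrow> ereal R"
  shows "ereal (2 / real CARD('m) * ((\<Sum>i\<in>UNIV. ln (a i)) - R))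
    \<le> liminf (\<lambda>k. ereal (1 / real k) * elog (\<integral>\<^sup>+\<omega>. ennreal ((norm (X k \<omega> - xs))\<^sup>2) \<partial>P))"
proof -
  interpret prob_space P by fact
  define near where "near i n \<longleftrightarrow> (\<forall>t\<ge>n. \<forall>w. \<bar>w - xs $ i\<bar> \<le> 1 / real (Suc n) \<longrightarrow>
      a i \<le> 1 + \<mu> t * deriv (deriv (U i)) w)" for i n
  have "\<forall>\<^sub>F n in sequentially. near i n" for i
    unfolding near_def using C2[of i] \<mu>(3) a(2)[of i]
    by (intro eventually_slope_near[where \<mu>s = \<mu>s])
      (auto simp: twice_continuously_differentiable_def continuous_on_eq_continuous_at)
  then have "\<forall>\<^sub>F n in sequentially. \<forall>i. near i n"
    by (rule eventually_all_finite)
  then obtain m where near: "\<And>i. near i m"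
    by (metis (mono_tags, lifting) eventually_happens sequentially_bot)
  define \<rho> where "\<rho> = 1 / real (Suc m)"
  define G where "G n = {\<omega> \<in> space P. px (X 0 \<omega>) \<le> real n \<and>
      (\<forall>t\<ge>n. norm (X t \<omega> - xs) \<le> \<rho>)}" for n
  have \<rho>: "0 < \<rho>" by (simp add: \<rho>_def)
  note good = prob_bounded_density_near_limit_tendsto_1[OF prob dens X lim \<rho>, folded G_def]
  have "\<forall>\<^sub>F n in sequentially. 1 / 2 < measure P (G n) \<and> max m 1 \<le> n"
    by (intro eventually_conj order_tendstoD(1)[OF good(2)] eventually_ge_at_top) auto
  then obtain n where "1 / 2 < measure P (G n) \<and> max m 1 \<le> n"
    by (metis (mono_tags, lifting) eventually_happens sequentially_bot)
  then have n: "1 / 2 \<le> measure P (G n)" "m \<le> n" "1 \<le> n" by auto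
  \<comment> \<open>before time \<open>n\<close> only the global curvature bound is available\<close>
  define s where "s i t = (if t < n then 1 + \<mu> t * Umin i else a i)" for i t
  have s_pos: "0 < s i t" for i t using \<mu>(2) a(1) by (simp add: s_def)
  have slope: "s i t \<le> 1 + \<mu> t * deriv (deriv (U i)) w"
    if "\<omega> \<in> G n" "\<omega>' \<in> G n" and w: "w \<in> closed_segment (X t \<omega> $ i) (X t \<omega>' $ i)" for \<omega> \<omega>' i t w
  proof (cases "t < n")
    case True
    then show ?thesis using Umin \<mu>(1) by (simp add: s_def mult_left_mono)
  next
    case False
    have "X t v $ i \<in> cball (xs $ i) \<rho>" if "v \<in> G n" for v
      using that False component_le_norm_cart[of "X t v - xs" i]
      by (auto simp: G_def dist_real_def abs_minus_commute not_less intro: order_trans)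
    with that have "closed_segment (X t \<omega> $ i) (X t \<omega>' $ i) \<subseteq> cball (xs $ i) \<rho>"
      by (intro closed_segment_subset) auto
    with w have "\<bar>w - xs $ i\<bar> \<le> \<rho>" by (auto simp: dist_real_def abs_minus_commute)
    with near[of i] False n(2) show ?thesis by (auto simp: near_def s_def \<rho>_def)
  qed
  define avg where "avg k = 1 / real k * (\<Sum>t<k. \<Sum>j\<in>UNIV. ln (real (card (alphabet_l Q j t))))" for k
  have avg: "avg \<longlonglongrightarrow> R"
    using rate unfolding average_rate_l_def[abs_def] avg_def[abs_def] by simp
  \<comment> \<open>the price of the finitely many early steps and of the density bound \<open>n\<close>, independent of \<open>k\<close>\<close>
  define K where "K = (\<Sum>i\<in>UNIV. (\<Sum>t<n. ln (s i t)) - real n * ln (a i)) - ln (4 * real n)"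
  define g where "g k = 2 / real CARD('m) * ((\<Sum>i\<in>UNIV. ln (a i)) + K / real k - avg k) - ln 64 / real k" for k
  have bound: "ereal (g k) \<le> ereal (1 / real k) * elog (\<integral>\<^sup>+\<omega>. ennreal ((norm (X k \<omega> - xs))\<^sup>2) \<partial>P)"
    if k: "n \<le> k" for k
  proof -
    have k0: "0 < real k" using k n(3) by simp
    have "(\<Sum>t<k. ln (s i t)) = ((\<Sum>t<n. ln (s i t)) - real n * ln (a i)) + real k * ln (a i)" for i
    proof -
      have "(\<Sum>t<k. ln (s i t)) = (\<Sum>t<n. ln (s i t)) + (\<Sum>t\<in>{n..<k}. ln (s i t))"
        using k by (subst sum.union_disjoint[symmetric]) (auto intro!: sum.cong)
      also have "(\<Sum>t\<in>{n..<k}. ln (s i t)) = real (k - n) * ln (a i)"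
        by (simp add: s_def)
      finally show ?thesis using k by (simp add: of_nat_diff algebra_simps)
    qed
    then have "(\<Sum>i\<in>UNIV. \<Sum>t<k. ln (s i t)) - ln (4 * real n) = K + real k * (\<Sum>i\<in>UNIV. ln (a i))"
      by (simp add: K_def sum.distrib sum_distrib_left)
    then have g: "g k = 1 / real k * (2 / real CARD('m) * ((\<Sum>i\<in>UNIV. \<Sum>t<k. ln (s i t)) - ln (4 * real n)
      - (\<Sum>t<k. \<Sum>j\<in>UNIV. ln (real (card (alphabet_l Q j t))))) - ln 64)"
      using k0 by (simp add: g_def avg_def field_simps)
    show ?thesis
      unfolding g times_ereal.simps(1)[symmetric] using n(3) k0
      by (intro ereal_mult_left_mono
          log_mean_square_error_ge[OF prob dens X algorithm scheme C2 good(1) n(1)] s_pos slope)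
        (auto simp: G_def)
  qed
  have "g \<longlonglongrightarrow> 2 / real CARD('m) * ((\<Sum>i\<in>UNIV. ln (a i)) + 0 - R) - 0"
    unfolding g_def[abs_def]
    by (intro tendsto_intros avg lim_const_over_n)
  then have "(\<lambda>k. ereal (g k)) \<longlonglongrightarrow> ereal (2 / real CARD('m) * ((\<Sum>i\<in>UNIV. ln (a i)) - R))"
    by simp
  then have "ereal (2 / real CARD('m) * ((\<Sum>i\<in>UNIV. ln (a i)) - R)) = liminf (\<lambda>k. ereal (g k))"
    by (intro lim_imp_Liminf[symmetric]) auto
  also have "\<dots> \<le> liminf (\<lambda>k. ereal (1 / real k) *
      elog (\<integral>\<^sup>+\<omega>. ennreal ((norm (X k \<omega> - xs))\<^sup>2) \<partial>P))"
    using bound by (intro Liminf_mono eventually_sequentiallyI[of n])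
  finally show ?thesis .
qed

theorem theorem2:
  fixes U :: "'m::finite \<Rightarrow> real \<Rightarrow> real"
    and A :: "real^'m^'n::finite" and b :: "real^'n"
    and xs :: "real^'m" and ls :: "real^'n"
    and Umin Umax :: "'m \<Rightarrow> real"
    and \<mu> :: "nat \<Rightarrow> real" and \<mu>s :: real
    and Q :: "('m, 'n, 's, 't) quantization_scheme"
    and P :: "'w measure"
    and X :: "nat \<Rightarrow> 'w \<Rightarrow> real^'m" and L :: "nat \<Rightarrow> 'w \<Rightarrow> real^'n"
    and px :: "real^'m \<Rightarrow> real" and pl :: "real^'n \<Rightarrow> real"
  assumes dims: "CARD('n) < CARD('m)"
    and primal: "primal_optimal U A b xs"
    and dual: "dual_optimal U A b ls"
    and U_concave: "\<And>i. concave_on UNIV (U i)"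
    and U_C2: "\<And>i. twice_continuously_differentiable (U i)"
    and U_bounds: "\<And>i x. Umin i \<le> deriv (deriv (U i)) x \<and> deriv (deriv (U i)) x \<le> Umax i"
    and Umax_neg: "\<And>i. Umax i < 0"
    and step_size: "\<And>k. 0 < \<mu> k \<and> \<mu> k < (MIN i. 1 / \<bar>Umin i\<bar>)"
    and step_lim: "\<mu> \<longlonglongrightarrow> \<mu>s" and step_lim_pos: "\<mu>s > 0"
    and prob: "prob_space P"
    and px_nonneg: "\<And>z. 0 \<le> px z" and pl_nonneg: "\<And>z. 0 \<le> pl z"
    and X0_density: "distributed P lborel (X 0) (\<lambda>z. ennreal (px z))"
    and L0_density: "distributed P lborel (L 0) (\<lambda>z. ennreal (pl z))"
    and indep: "independent_vectors P (X 0) (L 0)"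
    and px_entropy: "finite_differential_entropy px"
    and pl_entropy: "finite_differential_entropy pl"
    and scheme: "valid_scheme Q"
    and algorithm: "\<And>\<omega>. \<omega> \<in> space P \<Longrightarrow> pd_trajectory U A b \<mu> Q (\<lambda>k. X k \<omega>) (\<lambda>k. L k \<omega>)"
    and X_random: "\<And>k. X k \<in> borel_measurable P"
    and OA: "optimum_achieving U A b \<mu> px pl xs ls Q"
    and rate_exists: "convergent (average_rate_l Q)"
  shows "liminf (\<lambda>k. ereal (1 / real k) * elog (\<integral>\<^sup>+\<omega>. ennreal ((norm (X k \<omega> - xs))\<^sup>2) \<partial>P))
      \<ge> ereal (2 / real CARD('m)) *
        ((\<Sum>i\<in>UNIV. elog (ennreal (1 + \<mu>s * deriv (deriv (U i)) (xs $ i)))) - data_rate_l Q)"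
proof -
  define d where "d i = 1 + \<mu>s * deriv (deriv (U i)) (xs $ i)" for i
  let ?S = "\<Sum>i\<in>UNIV. elog (ennreal (d i))"
  let ?E = "\<lambda>k. ereal (1 / real k) * elog (\<integral>\<^sup>+\<omega>. ennreal ((norm (X k \<omega> - xs))\<^sup>2) \<partial>P)"
  have R0: "0 \<le> data_rate_l Q"
    using scheme rate_exists by (rule data_rate_l_nonneg)
  have rate: "average_rate_l Q \<longlonglongrightarrow> data_rate_l Q"
    using rate_exists by (simp add: convergent_LIMSEQ_iff data_rate_l_def)
  have Umin: "Umin i < 0" for i
    using U_bounds[of i 0] Umax_neg[of i] by linarith
  have contraction: "0 < 1 + \<mu> k * Umin i" for k i
  proof -
    have "\<mu> k < 1 / \<bar>Umin i\<bar>"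
      using step_size[of k] by (rule conjunct2[THEN less_le_trans]) (auto intro: Min_le)
    then show ?thesis using Umin[of i] by (simp add: field_simps)
  qed
  have conv: "AE \<omega> in P. (\<lambda>k. X k \<omega>) \<longlonglongrightarrow> xs"
    using AE_density_pos[OF prob X0_density] AE_density_pos[OF prob L0_density] AE_space
    by eventually_elim (use OA algorithm in \<open>auto simp: optimum_achieving_def density_support_def\<close>)
  have liminf_ge: "ereal (2 / real CARD('m) * ((\<Sum>i\<in>UNIV. ln (a i)) - R)) \<le> liminf ?E"
    if "\<And>i. 0 < a i" "\<And>i. a i < d i" "average_rate_l Q \<longlonglongrightarrow> ereal R" for a R
    using that U_bounds step_size unfolding d_def
    by (intro liminf_log_mean_square_error_ge[OF prob X0_density X_random conv algorithm scheme U_C2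
          _ _ contraction step_lim]) (auto intro: less_imp_le)
  show ?thesis
  proof (cases "(\<forall>i. 0 < d i) \<and> data_rate_l Q \<noteq> \<infinity>")
    case True
    then obtain R where R: "data_rate_l Q = ereal R"
      using R0 by (cases "data_rate_l Q") auto
    have S: "?S = ereal (\<Sum>i\<in>UNIV. ln (d i))"
      using True by (simp add: elog_ennreal)
    show ?thesis
      unfolding d_def[symmetric] S R
    proof (rule ereal_le_epsilon2)
      fix e :: real assume e: "0 < e"
      define a where "a i = exp (- (e / 2)) * d i" for i
      have a: "0 < a i" "a i < d i" for i
        using True e by (auto simp: a_def)
      have "ln (a i) = ln (d i) - e / 2" for i
        using True by (simp add: a_def ln_mult less_imp_neq[symmetric])
      then have "(\<Sum>i\<in>UNIV. ln (a i)) = (\<Sum>i\<in>UNIV. ln (d i)) - real CARD('m) * (e / 2)"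
        by (simp only: sum_subtractf sum_constant)
      then have "2 / real CARD('m) * ((\<Sum>i\<in>UNIV. ln (a i)) - R) =
          2 / real CARD('m) * ((\<Sum>i\<in>UNIV. ln (d i)) - R) - e"
        by (simp add: field_simps)
      with liminf_ge[OF a rate[unfolded R]]
      have "ereal (2 / real CARD('m) * ((\<Sum>i\<in>UNIV. ln (d i)) - R) - e) \<le> liminf ?E" by simp
      then show "ereal (2 / real CARD('m)) * (ereal (\<Sum>i\<in>UNIV. ln (d i)) - ereal R) \<le> liminf ?E + ereal e"
        by (cases "liminf ?E") auto
    qed
  next
    case False
    \<comment> \<open>a limiting slope 0 (\<open>\<mu>s\<close> may equal \<open>1 / \<bar>Umin i\<bar>\<close>) or an infinite rate makes the bound \<open>-\<infinity>\<close>\<close>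
    have not_top: "elog (ennreal (d i)) \<noteq> \<infinity>" for i by (simp add: elog_ennreal)
    have "?S - data_rate_l Q = -\<infinity>"
    proof (cases "\<forall>i. 0 < d i")
      case True
      with False show ?thesis by (simp add: elog_ennreal)
    next
      case neg: False
      then obtain j where "elog (ennreal (d j)) = -\<infinity>" by (auto simp: elog_ennreal)
      then have "?S = -\<infinity>" using not_top by (intro sum_ereal_eq_MInfty) auto
      then show ?thesis using R0 by (cases "data_rate_l Q") auto
    qed
    then show ?thesis unfolding d_def by simp
  qed
qed

end
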